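(* Let $a<b$ and let $p,s,q,\omega\in C([a,b])$ be real-valued with $p>0$ and $\omega>0$ on $[a,b]$. For each $\lambda\in\mathbb{R}$, let $y_\lambda$ be a (nontrivial) real-valued solution on $[a,b]$ of $$-\left(p(x)\left(y'(x)+s(x)y(x)\right)\right)'+s(x)p(x)\left(y'(x)+s(x)y(x)\right)+q(x)y(x)=\lambda\,\omega(x)y(x)$$ with $y_\lambda(a)=0$ and $y_\lambda'(a)>0$, and denote its successive zeros in $(a,b]$ by $$x_1(\lambda)<x_2(\lambda)<\cdots .$$ Then, for any real $\mu>\lambda$, and for every $k$ for which $x_k(\lambda)$ exists, the zero $x_k(\mu)$ exists as well and $$x_k(\mu)<x_k(\lambda).$$
   Context: A solution of the equation is a differentiable function $y$ on $[a,b]$ such that the quasi-derivative $p(y'+sy)$ is also differentiable on $[a,b]$ (one-sided derivatives at the endpoints) and the equation holds at every point. *)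

theory Defs
  imports "HOL-Analysis.Analysis"
begin

text \<open>Derivative relative to the interval: one-sided at the endpoints. The value is only
  meaningful where the function is differentiable within \<open>{a..b}\<close> and \<open>a < b\<close>.\<close>

definition deriv_on :: "real \<Rightarrow> real \<Rightarrow> (real \<Rightarrow> real) \<Rightarrow> real \<Rightarrow> real" where
  "deriv_on a b f x = vector_derivative f (at x within {a..b})"

definition quasi_deriv ::
  "real \<Rightarrow> real \<Rightarrow> (real \<Rightarrow> real) \<Rightarrow> (real \<Rightarrow> real) \<Rightarrow> (real \<Rightarrow> real) \<Rightarrow> real \<Rightarrow> real" where
  "quasi_deriv a b p s y x = p x * (deriv_on a b y x + s x * y x)"

definition sl_solution ::
  "real \<Rightarrow> real \<Rightarrow> (real \<Rightarrow> real) \<Rightarrow> (real \<Rightarrow> real) \<Rightarrow> (real \<Rightarrow> real) \<Rightarrow> (real \<Rightarrow> real) \<Rightarrow> real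
    \<Rightarrow> (real \<Rightarrow> real) \<Rightarrow> bool" where
  "sl_solution a b p s q \<omega> l y \<longleftrightarrow>
     y differentiable_on {a..b} \<and>
     quasi_deriv a b p s y differentiable_on {a..b} \<and>
     (\<forall>x\<in>{a..b}. - deriv_on a b (quasi_deriv a b p s y) x
                  + s x * quasi_deriv a b p s y x + q x * y x = l * \<omega> x * y x)"

text \<open>\<open>kth_zero a b y k t\<close>: the \<open>k\<close>-th zero of \<open>y\<close> in \<open>(a,b]\<close> in increasing order, counted
  from \<open>1\<close>, exists and equals \<open>t\<close>. The endpoint \<open>a\<close> is not counted even if \<open>y a = 0\<close>.\<close>

definition kth_zero :: "real \<Rightarrow> real \<Rightarrow> (real \<Rightarrow> real) \<Rightarrow> nat \<Rightarrow> real \<Rightarrow> bool" where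
  "kth_zero a b y k t \<longleftrightarrow>
     k \<ge> 1 \<and> t \<in> {a<..b} \<and> y t = 0 \<and>
     finite {x \<in> {a<..t}. y x = 0} \<and> card {x \<in> {a<..t}. y x = 0} = k"

lemma kth_zero_strict_mono:
  assumes "kth_zero a b y j t" "kth_zero a b y k u" "j < k"
  shows "t < u"
proof (rule ccontr)
  assume "\<not> t < u"
  then have "{x \<in> {a<..u}. y x = 0} \<subseteq> {x \<in> {a<..t}. y x = 0}" by auto
  then have "k \<le> j"
    using assms(1,2) card_mono unfolding kth_zero_def by blast
  then show False using assms(3) by simp
qed

lemma kth_zero_unique:
  assumes "kth_zero a b y k t" "kth_zero a b y k u"
  shows "t = u"
proof -
  have less: False if "kth_zero a b y k v" "kth_zero a b y k w" "v < w" for v w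
  proof -
    have "w \<in> {x \<in> {a<..w}. y x = 0} - {x \<in> {a<..v}. y x = 0}"
      using that unfolding kth_zero_def by auto
    moreover have "{x \<in> {a<..v}. y x = 0} \<subseteq> {x \<in> {a<..w}. y x = 0}"
      using that by auto
    ultimately have "{x \<in> {a<..v}. y x = 0} \<subset> {x \<in> {a<..w}. y x = 0}" by blast
    then have "k < k"
      using that(1,2) psubset_card_mono unfolding kth_zero_def by metis
    then show False by simp
  qed
  show ?thesis
    using less[of t u] less[of u t] assms by (cases t u rule: linorder_cases) auto
qed

end

theory Submission
  imports Defs
begin

text \<open>
  The proof is Sturm's comparison argument. In terms of \<open>u\<close> and its quasi-derivative
  \<open>U = p (u' + s u)\<close> the equation is the linear first-order system
  \<open>u' = U / p - s u\<close>, \<open>U' = s U + (q - \<lambda> \<omega>) u\<close>, whose coefficients are continuous. If \<open>(u, U)\<close>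
  and \<open>(v, V)\<close> solve it for the parameters \<open>\<lambda>\<close> and \<open>\<mu>\<close>, the terms with \<open>p\<close>, \<open>s\<close> and \<open>q\<close> cancel in
  the derivative of the Wronskian: \<open>(U v - u V)' = (\<mu> - \<lambda>) \<omega> u v\<close>. Between neighbouring zeros
  \<open>c < d\<close> of \<open>u\<close> the function \<open>v\<close> must therefore vanish: otherwise, after a change of signs, both
  functions are positive there, so that the Wronskian strictly increases, whereas it is \<open>U v \<ge> 0\<close> at
  \<open>c\<close> and \<open>U v \<le> 0\<close> at \<open>d\<close> (lemma \<open>sturm_comparison\<close>).

  Applied with \<open>\<lambda> < \<mu>\<close> to the points \<open>a < x\<^sub>1(\<lambda>) < \<dots> < x\<^sub>k(\<lambda>)\<close>, this yields \<open>k\<close> distinct zeros of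
  \<open>y\<^sub>\<mu>\<close> strictly between \<open>a\<close> and \<open>x\<^sub>k(\<lambda>)\<close>. To conclude that a \<open>k\<close>-th zero exists it remains to exclude
  infinitely many zeros (lemma \<open>finite_zeros\<close>): at an accumulation point of zeros both \<open>y\<^sub>\<mu>\<close> and
  its quasi-derivative would vanish, and \<open>y\<^sub>\<mu>\<close> would be trivial by uniqueness for linear systems.
\<close>

section \<open>The first-order system\<close>

text \<open>
  The quasi-derivative is a second unknown \<open>U\<close> rather than a function of \<open>u\<close>: the pair solves a linear
  system in which \<open>p\<close> and \<open>s\<close> are never differentiated, so continuity of the coefficients suffices.
\<close>

definition sl_system ::
  "real \<Rightarrow> real \<Rightarrow> (real \<Rightarrow> real) \<Rightarrow> (real \<Rightarrow> real) \<Rightarrow> (real \<Rightarrow> real) \<Rightarrow> (real \<Rightarrow> real) \<Rightarrow> real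
    \<Rightarrow> (real \<Rightarrow> real) \<Rightarrow> (real \<Rightarrow> real) \<Rightarrow> bool" where
  "sl_system a b p s q \<omega> l u U \<longleftrightarrow> (\<forall>x\<in>{a..b}.
     (u has_real_derivative U x / p x - s x * u x) (at x within {a..b}) \<and>
     (U has_real_derivative s x * U x + (q x - l * \<omega> x) * u x) (at x within {a..b}))"

lemma has_deriv_on:
  assumes "f differentiable_on {a..b}" "x \<in> {a..b}"
  shows "(f has_real_derivative deriv_on a b f x) (at x within {a..b})"
  using assms unfolding differentiable_on_def deriv_on_def
  by (simp add: has_real_derivative_iff_has_vector_derivative flip: vector_derivative_works)

lemma sl_solution_imp_sl_system:
  assumes "sl_solution a b p s q \<omega> l y" and pos: "\<And>x. x \<in> {a..b} \<Longrightarrow> p x > 0"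
  shows "sl_system a b p s q \<omega> l y (quasi_deriv a b p s y)"
  unfolding sl_system_def
proof (intro ballI conjI)
  fix x assume x: "x \<in> {a..b}"
  have "deriv_on a b y x = quasi_deriv a b p s y x / p x - s x * y x"
    using pos[OF x] by (simp add: quasi_deriv_def)
  then show "(y has_real_derivative quasi_deriv a b p s y x / p x - s x * y x) (at x within {a..b})"
    using has_deriv_on[OF _ x, of y] assms(1) unfolding sl_solution_def by metis
  have "- deriv_on a b (quasi_deriv a b p s y) x + s x * quasi_deriv a b p s y x + q x * y x
      = l * \<omega> x * y x"
    using assms(1) x unfolding sl_solution_def by blast
  then have "deriv_on a b (quasi_deriv a b p s y) x
      = s x * quasi_deriv a b p s y x + (q x - l * \<omega> x) * y x"
    by (simp add: algebra_simps)
  then show "(quasi_deriv a b p s y has_real_derivative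
      s x * quasi_deriv a b p s y x + (q x - l * \<omega> x) * y x) (at x within {a..b})"
    using has_deriv_on[OF _ x, of "quasi_deriv a b p s y"] assms(1)
    unfolding sl_solution_def by metis
qed

lemma sl_system_scale:
  assumes "sl_system a b p s q \<omega> l u U"
  shows "sl_system a b p s q \<omega> l (\<lambda>x. \<sigma> * u x) (\<lambda>x. \<sigma> * U x)"
  unfolding sl_system_def
proof (intro ballI conjI)
  fix x assume x: "x \<in> {a..b}"
  have d: "(u has_real_derivative U x / p x - s x * u x) (at x within {a..b})"
    "(U has_real_derivative s x * U x + (q x - l * \<omega> x) * u x) (at x within {a..b})"
    using assms x unfolding sl_system_def by auto
  show "((\<lambda>x. \<sigma> * u x) has_real_derivative \<sigma> * U x / p x - s x * (\<sigma> * u x)) (at x within {a..b})"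
    using DERIV_cmult[OF d(1), of \<sigma>] by (simp add: algebra_simps)
  show "((\<lambda>x. \<sigma> * U x) has_real_derivative s x * (\<sigma> * U x) + (q x - l * \<omega> x) * (\<sigma> * u x))
      (at x within {a..b})"
    using DERIV_cmult[OF d(2), of \<sigma>] by (simp add: algebra_simps)
qed

lemma sl_system_continuous:
  assumes "sl_system a b p s q \<omega> l u U"
  shows "continuous_on {a..b} u" "continuous_on {a..b} U"
  using assms unfolding sl_system_def by (auto intro!: DERIV_continuous_on)

lemma at_within_Icc_interior: "a < x \<Longrightarrow> x < b \<Longrightarrow> at x within {a..b} = at (x::real)"
  by (rule at_within_interior) simp

section \<open>Uniqueness and finiteness of zeros\<close>

text \<open>
  Gronwall's inequality in both directions: \<open>e\<^sup>-\<^sup>K\<^sup>x E\<close> is nonincreasing and \<open>e\<^sup>K\<^sup>x E\<close> is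
  nondecreasing, so a zero of \<open>E\<close> propagates to the right by the former and to the left by the latter.
\<close>

lemma gronwall_zero:
  fixes E E' :: "real \<Rightarrow> real"
  assumes der: "\<And>x. x \<in> {a..b} \<Longrightarrow> (E has_real_derivative E' x) (at x within {a..b})"
    and bound: "\<And>x. x \<in> {a..b} \<Longrightarrow> \<bar>E' x\<bar> \<le> K * E x"
    and nonneg: "\<And>x. x \<in> {a..b} \<Longrightarrow> E x \<ge> 0"
    and c: "c \<in> {a..b}" "E c = 0" and x: "x \<in> {a..b}"
  shows "E x = 0"
proof -
  have cont: "continuous_on {a..b} E"
    using der by (rule DERIV_continuous_on)
  have der': "(E has_real_derivative E' z) (at z)" if "a < z" "z < b" for z
    using der[of z] that by (simp add: at_within_Icc_interior)
  consider "x < c" | "x = c" | "c < x" by linarith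
  then have "E x \<le> 0"
  proof cases
    case 1
    have "exp (K * x) * E x \<le> exp (K * c) * E c"
    proof (rule DERIV_nonneg_imp_increasing_open[of x c "\<lambda>z. exp (K * z) * E z"])
      show "continuous_on {x..c} (\<lambda>z. exp (K * z) * E z)"
        using c(1) x by (intro continuous_intros continuous_on_subset[OF cont]) auto
      fix z assume z: "x < z" "z < c"
      have "((\<lambda>z. exp (K * z) * E z) has_real_derivative exp (K * z) * (K * E z + E' z)) (at z)"
        using z c(1) x by (auto intro!: derivative_eq_intros der' simp: algebra_simps)
      moreover have "exp (K * z) * (K * E z + E' z) \<ge> 0"
        using bound[of z] z c(1) x by auto
      ultimately show "\<exists>D. ((\<lambda>z. exp (K * z) * E z) has_real_derivative D) (at z) \<and> 0 \<le> D"
        by blast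
    qed (use 1 in simp)
    then show ?thesis using c(2) by (simp add: mult_le_0_iff)
  next
    case 2 then show ?thesis using c by simp
  next
    case 3
    have "exp (- K * x) * E x \<le> exp (- K * c) * E c"
    proof (rule DERIV_nonpos_imp_decreasing_open[of c x "\<lambda>z. exp (- K * z) * E z"])
      show "continuous_on {c..x} (\<lambda>z. exp (- K * z) * E z)"
        using c(1) x by (intro continuous_intros continuous_on_subset[OF cont]) auto
      fix z assume z: "c < z" "z < x"
      have "((\<lambda>z. exp (- K * z) * E z) has_real_derivative exp (- K * z) * (E' z - K * E z)) (at z)"
        using z c(1) x by (auto intro!: derivative_eq_intros der' simp: algebra_simps)
      moreover have "exp (- K * z) * (E' z - K * E z) \<le> 0"
        using bound[of z] z c(1) x by (auto simp: mult_le_0_iff)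
      ultimately show "\<exists>D. ((\<lambda>z. exp (- K * z) * E z) has_real_derivative D) (at z) \<and> D \<le> 0"
        by blast
    qed (use 3 in simp)
    then show ?thesis using c(2) by (simp add: mult_le_0_iff)
  qed
  then show ?thesis using nonneg[OF x] by simp
qed

text \<open>
  The energy \<open>u\<^sup>2 + U\<^sup>2\<close> satisfies Gronwall's hypothesis because the coefficients of the system are
  bounded on the compact interval.
\<close>

lemma sl_system_zero_unique:
  assumes sys: "sl_system a b p s q \<omega> l u U"
    and cont: "continuous_on {a..b} p" "continuous_on {a..b} s"
      "continuous_on {a..b} q" "continuous_on {a..b} \<omega>"
    and pos: "\<And>x. x \<in> {a..b} \<Longrightarrow> p x > 0"
    and c: "c \<in> {a..b}" "u c = 0" "U c = 0" and x: "x \<in> {a..b}"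
  shows "u x = 0"
proof -
  define h where "h z = \<bar>2 * s z\<bar> + \<bar>1 / p z + q z - l * \<omega> z\<bar>" for z
  have "continuous_on {a..b} h"
    unfolding h_def using pos by (intro continuous_intros cont) force
  then have "bounded (h ` {a..b})"
    by (simp add: compact_continuous_image compact_imp_bounded)
  then obtain K where K: "\<And>z. z \<in> {a..b} \<Longrightarrow> \<bar>h z\<bar> \<le> K"
    unfolding bounded_iff by fastforce
  define E' where "E' z = 2 * (u z * (U z / p z - s z * u z))
      + 2 * (U z * (s z * U z + (q z - l * \<omega> z) * u z))" for z
  have "(u x)\<^sup>2 + (U x)\<^sup>2 = 0"
  proof (rule gronwall_zero[where E = "\<lambda>z. (u z)\<^sup>2 + (U z)\<^sup>2" and E' = E' and K = K, OF _ _ _ c(1) _ x])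
    fix z assume z: "z \<in> {a..b}"
    show "((\<lambda>z. (u z)\<^sup>2 + (U z)\<^sup>2) has_real_derivative E' z) (at z within {a..b})"
      using sys z unfolding sl_system_def E'_def by (auto intro!: derivative_eq_intros)
    have "E' z = 2 * s z * ((U z)\<^sup>2 - (u z)\<^sup>2) + (1 / p z + q z - l * \<omega> z) * (2 * u z * U z)"
      using pos[OF z] unfolding E'_def by (simp add: field_simps power2_eq_square)
    also have "\<bar>\<dots>\<bar> \<le> \<bar>2 * s z\<bar> * \<bar>(U z)\<^sup>2 - (u z)\<^sup>2\<bar> + \<bar>1 / p z + q z - l * \<omega> z\<bar> * \<bar>2 * u z * U z\<bar>"
      by (metis abs_mult abs_triangle_ineq)
    also have "\<dots> \<le> \<bar>2 * s z\<bar> * ((u z)\<^sup>2 + (U z)\<^sup>2) + \<bar>1 / p z + q z - l * \<omega> z\<bar> * ((u z)\<^sup>2 + (U z)\<^sup>2)"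
    proof (intro add_mono mult_left_mono)
      show "\<bar>(U z)\<^sup>2 - (u z)\<^sup>2\<bar> \<le> (u z)\<^sup>2 + (U z)\<^sup>2" by (simp add: abs_le_iff)
      show "\<bar>2 * u z * U z\<bar> \<le> (u z)\<^sup>2 + (U z)\<^sup>2"
        using sum_squares_bound[of "\<bar>u z\<bar>" "\<bar>U z\<bar>"] by (simp add: abs_mult)
    qed auto
    also have "\<dots> = h z * ((u z)\<^sup>2 + (U z)\<^sup>2)" by (simp add: h_def algebra_simps)
    also have "\<dots> \<le> K * ((u z)\<^sup>2 + (U z)\<^sup>2)"
      using K[OF z] by (intro mult_right_mono) auto
    finally show "\<bar>E' z\<bar> \<le> K * ((u z)\<^sup>2 + (U z)\<^sup>2)" .
  qed (use c in auto)
  then show ?thesis by (simp add: sum_power2_eq_zero_iff)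
qed

lemma deriv_zero_at_limit_of_zeros:
  fixes f :: "real \<Rightarrow> real"
  assumes f: "(f has_real_derivative D) (at c within S)"
    and lim: "c islimpt Z" and Z: "Z \<subseteq> S" "\<And>z. z \<in> Z \<Longrightarrow> f z = 0"
  shows "f c = 0" "D = 0"
proof -
  have nontriv: "at c within Z \<noteq> bot"
    using lim by (simp add: trivial_limit_within)
  have fZ: "(f has_real_derivative D) (at c within Z)"
    using f Z(1) by (rule DERIV_subset)
  then have "(f \<longlongrightarrow> f c) (at c within Z)"
    using DERIV_continuous continuous_within by blast
  moreover have "(f \<longlongrightarrow> 0) (at c within Z)"
    by (rule tendsto_eventually) (auto simp: eventually_at_filter Z(2))
  ultimately show fc: "f c = 0"
    using nontriv tendsto_unique by blast
  have "((\<lambda>x. (f x - f c) / (x - c)) \<longlongrightarrow> D) (at c within Z)"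
    using fZ by (simp add: has_field_derivative_iff)
  moreover have "((\<lambda>x. (f x - f c) / (x - c)) \<longlongrightarrow> 0) (at c within Z)"
    by (rule tendsto_eventually) (auto simp: eventually_at_filter Z(2) fc)
  ultimately show "D = 0"
    using nontriv tendsto_unique by blast
qed

text \<open>
  Infinitely many zeros accumulate in the compact interval; at the accumulation point \<open>u = u' = 0\<close>,
  hence \<open>U = p (u' + s u) = 0\<close>, which contradicts uniqueness.
\<close>

lemma finite_zeros:
  assumes sys: "sl_system a b p s q \<omega> l u U"
    and cont: "continuous_on {a..b} p" "continuous_on {a..b} s"
      "continuous_on {a..b} q" "continuous_on {a..b} \<omega>"
    and pos: "\<And>x. x \<in> {a..b} \<Longrightarrow> p x > 0"
    and nontriv: "\<exists>x\<in>{a..b}. u x \<noteq> 0"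
  shows "finite {x \<in> {a..b}. u x = 0}"
proof (rule ccontr)
  let ?Z = "{x \<in> {a..b}. u x = 0}"
  assume "infinite ?Z"
  then obtain c where c: "c \<in> {a..b}" "c islimpt ?Z"
    using compact_Icc[of a b] unfolding compact_eq_Bolzano_Weierstrass
    by (metis (no_types, lifting) mem_Collect_eq subsetI)
  have "(u has_real_derivative U c / p c - s c * u c) (at c within {a..b})"
    using sys c(1) unfolding sl_system_def by blast
  then have "u c = 0" "U c / p c - s c * u c = 0"
    by (rule deriv_zero_at_limit_of_zeros[OF _ c(2)]; auto)+
  moreover from this have "U c = 0"
    using pos[OF c(1)] by simp
  ultimately show False
    using sl_system_zero_unique[OF sys cont pos c(1)] nontriv by blast
qed

section \<open>Sturm comparison\<close>

lemma wronskian_deriv: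
  assumes "sl_system a b p s q \<omega> l u U" "sl_system a b p s q \<omega> m v V" "x \<in> {a..b}"
  shows "((\<lambda>x. U x * v x - u x * V x) has_real_derivative (m - l) * \<omega> x * u x * v x)
    (at x within {a..b})"
proof -
  have u: "(u has_real_derivative U x / p x - s x * u x) (at x within {a..b})"
    "(U has_real_derivative s x * U x + (q x - l * \<omega> x) * u x) (at x within {a..b})"
    and v: "(v has_real_derivative V x / p x - s x * v x) (at x within {a..b})"
    "(V has_real_derivative s x * V x + (q x - m * \<omega> x) * v x) (at x within {a..b})"
    using assms unfolding sl_system_def by auto
  have "(s x * U x + (q x - l * \<omega> x) * u x) * v x + (V x / p x - s x * v x) * U x
      - ((U x / p x - s x * u x) * V x + (s x * V x + (q x - m * \<omega> x) * v x) * u x)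
      = (m - l) * \<omega> x * u x * v x"
    by (simp add: algebra_simps)
  then show ?thesis
    using DERIV_diff[OF DERIV_mult[OF u(2) v(1)] DERIV_mult[OF u(1) v(2)]] by metis
qed

text \<open>
  The contradiction behind the comparison theorem: the Wronskian strictly increases although its
  boundary values, where only \<open>U v\<close> survives, force \<open>W(c) \<ge> 0 \<ge> W(d)\<close>. Here \<open>U(c) \<ge> 0 \<ge> U(d)\<close>
  because \<open>U\<close> has the sign of \<open>u'\<close> at a zero of \<open>u\<close>, and \<open>v \<ge> 0\<close> at both ends by continuity. As the
  increase is strict, these weak signs suffice, and \<open>v\<close> may vanish at \<open>c\<close> or \<open>d\<close>.
\<close>

lemma sturm_positive_contradiction:
  assumes u: "sl_system a b p s q \<omega> l u U" and v: "sl_system a b p s q \<omega> m v V"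
    and pos: "\<And>x. x \<in> {a..b} \<Longrightarrow> p x > 0" "\<And>x. x \<in> {a..b} \<Longrightarrow> \<omega> x > 0"
    and "l < m" and cd: "a \<le> c" "c < d" "d \<le> b" and zero: "u c = 0" "u d = 0"
    and upos: "\<And>x. c < x \<Longrightarrow> x < d \<Longrightarrow> u x > 0" and vpos: "\<And>x. c < x \<Longrightarrow> x < d \<Longrightarrow> v x > 0"
  shows False
proof -
  define W where "W x = U x * v x - u x * V x" for x
  have "W c < W d"
  proof (rule DERIV_pos_imp_increasing_open[OF cd(2)])
    show "continuous_on {c..d} W"
      unfolding W_def using cd
      by (intro continuous_intros continuous_on_subset[OF sl_system_continuous(1)[OF u]]
          continuous_on_subset[OF sl_system_continuous(2)[OF u]]
          continuous_on_subset[OF sl_system_continuous(1)[OF v]]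
          continuous_on_subset[OF sl_system_continuous(2)[OF v]]) auto
    fix x assume x: "c < x" "x < d"
    have "(W has_real_derivative (m - l) * \<omega> x * u x * v x) (at x)"
      using wronskian_deriv[OF u v, of x] x cd unfolding W_def
      by (simp add: at_within_Icc_interior)
    moreover have "(m - l) * \<omega> x * u x * v x > 0"
      using \<open>l < m\<close> pos(2)[of x] upos[OF x] vpos[OF x] x cd by simp
    ultimately show "\<exists>D. (W has_real_derivative D) (at x) \<and> D > 0" by blast
  qed
  have v_nonneg: "v x \<ge> 0" if "x \<in> {c..d}" for x
  proof (rule continuous_ge_on_closure[of "{c<..<d}" v])
    show "continuous_on (closure {c<..<d}) v"
      using cd by (simp add: continuous_on_subset[OF sl_system_continuous(1)[OF v]])
    show "x \<in> closure {c<..<d}" using that cd by simp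
  qed (auto intro: less_imp_le vpos)
  have du: "(u has_real_derivative U x / p x - s x * u x) (at x within {c..d})" if "x \<in> {c..d}" for x
  proof (rule DERIV_subset)
    show "(u has_real_derivative U x / p x - s x * u x) (at x within {a..b})"
      using u that cd unfolding sl_system_def by simp
  qed (use cd in auto)
  have "U c \<ge> 0"
  proof (rule ccontr)
    assume "\<not> U c \<ge> 0"
    then have "U c / p c - s c * u c < 0"
      using pos(1)[of c] cd zero by (simp add: divide_neg_pos)
    then obtain e where e: "e > 0" "\<And>h. h > 0 \<Longrightarrow> c + h \<in> {c..d} \<Longrightarrow> h < e \<Longrightarrow> u c > u (c + h)"
      using has_real_derivative_neg_dec_right[OF du[of c]] cd by auto
    define h where "h = min (e / 2) ((d - c) / 2)"
    have "h > 0" "h < e" "c + h < d" using e(1) cd unfolding h_def by (auto simp: min_def field_simps)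
    then have "u (c + h) < 0" "u (c + h) > 0"
      using e(2)[of h] upos[of "c + h"] zero by simp_all
    then show False by simp
  qed
  moreover have "U d \<le> 0"
  proof (rule ccontr)
    assume "\<not> U d \<le> 0"
    then have "U d / p d - s d * u d > 0"
      using pos(1)[of d] cd zero by simp
    then obtain e where e: "e > 0" "\<And>h. h > 0 \<Longrightarrow> d - h \<in> {c..d} \<Longrightarrow> h < e \<Longrightarrow> u (d - h) < u d"
      using has_real_derivative_pos_inc_left[OF du[of d]] cd by auto
    define h where "h = min (e / 2) ((d - c) / 2)"
    have "h > 0" "h < e" "c < d - h" using e(1) cd unfolding h_def by (auto simp: min_def field_simps)
    then have "u (d - h) < 0" "u (d - h) > 0"
      using e(2)[of h] upos[of "d - h"] zero by simp_all
    then show False by simp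
  qed
  ultimately have "W c \<ge> 0" "W d \<le> 0"
    using v_nonneg[of c] v_nonneg[of d] cd zero unfolding W_def by (auto simp: mult_nonpos_nonneg)
  then show False using \<open>W c < W d\<close> by simp
qed

lemma nonvanishing_constant_sign:
  fixes f :: "real \<Rightarrow> real"
  assumes cont: "continuous_on {c<..<d} f" and nz: "\<And>x. c < x \<Longrightarrow> x < d \<Longrightarrow> f x \<noteq> 0"
  obtains \<sigma> :: real where "\<And>x. c < x \<Longrightarrow> x < d \<Longrightarrow> \<sigma> * f x > 0"
proof -
  have "connected (f ` {c<..<d})"
    using cont by (simp add: connected_continuous_image)
  then have "0 \<in> f ` {c<..<d}" if "f x < 0" "f z > 0" "x \<in> {c<..<d}" "z \<in> {c<..<d}" for x z
    using connectedD_interval[of "f ` {c<..<d}" "f x" "f z" 0] that by auto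
  then have "(\<forall>x\<in>{c<..<d}. f x > 0) \<or> (\<forall>x\<in>{c<..<d}. f x < 0)"
    using nz by (metis (no_types, lifting) greaterThanLessThan_iff imageE linorder_neqE_linordered_idom)
  then show thesis
    using that[of 1] that[of "-1"] by auto
qed

text \<open>
  A nonvanishing function has constant sign, and the system is linear, so both solutions can be taken
  positive.
\<close>

lemma sturm_comparison:
  assumes u: "sl_system a b p s q \<omega> l u U" and v: "sl_system a b p s q \<omega> m v V"
    and pos: "\<And>x. x \<in> {a..b} \<Longrightarrow> p x > 0" "\<And>x. x \<in> {a..b} \<Longrightarrow> \<omega> x > 0"
    and "l < m" and cd: "a \<le> c" "c < d" "d \<le> b" and zero: "u c = 0" "u d = 0"
    and unz: "\<And>x. c < x \<Longrightarrow> x < d \<Longrightarrow> u x \<noteq> 0"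
  obtains z where "c < z" "z < d" "v z = 0"
proof (rule ccontr)
  assume "\<not> thesis"
  then have vnz: "v x \<noteq> 0" if "c < x" "x < d" for x
    using that(1,2) \<open>\<And>z. \<lbrakk>c < z; z < d; v z = 0\<rbrakk> \<Longrightarrow> thesis\<close> by blast
  have sub: "{c<..<d} \<subseteq> {a..b}" using cd by auto
  obtain \<sigma> where \<sigma>: "\<And>x. c < x \<Longrightarrow> x < d \<Longrightarrow> \<sigma> * u x > 0"
    using nonvanishing_constant_sign[OF continuous_on_subset[OF sl_system_continuous(1)[OF u] sub] unz]
    by blast
  obtain \<tau> where \<tau>: "\<And>x. c < x \<Longrightarrow> x < d \<Longrightarrow> \<tau> * v x > 0"
    using nonvanishing_constant_sign[OF continuous_on_subset[OF sl_system_continuous(1)[OF v] sub] vnz]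
    by blast
  show False
    by (rule sturm_positive_contradiction[OF sl_system_scale[OF u, of \<sigma>] sl_system_scale[OF v, of \<tau>]
          pos \<open>l < m\<close> cd _ _ \<sigma> \<tau>]) (auto simp: zero)
qed

section \<open>Counting zeros\<close>

text \<open>
  If the gap between each point of \<open>A\<close> and its predecessor in \<open>insert a A\<close> contains a point of \<open>Z\<close>,
  then \<open>Z\<close> has at least as many points as \<open>A\<close>, since points in different gaps are different. The
  gap below \<open>x\<close> is described as the set of \<open>z < x\<close> exceeding every smaller element of \<open>insert a A\<close>.
\<close>

lemma card_le_if_gaps_hit:
  fixes A Z :: "real set"
  assumes "finite Z"
    and gaps: "\<And>x. x \<in> A \<Longrightarrow> \<exists>z\<in>Z. z < x \<and> (\<forall>c\<in>insert a A. c < x \<longrightarrow> c < z)"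
  shows "card A \<le> card Z"
proof -
  obtain g where g: "\<And>x. x \<in> A \<Longrightarrow> g x \<in> Z \<and> g x < x \<and> (\<forall>c\<in>insert a A. c < x \<longrightarrow> c < g x)"
    using gaps by metis
  have "g x < g x'" if "x \<in> A" "x' \<in> A" "x < x'" for x x'
    using g[of x] g[of x'] that by force
  then have "inj_on g A"
    by (metis inj_onI less_irrefl linorder_neqE_linordered_idom)
  moreover have "g ` A \<subseteq> Z" using g by auto
  ultimately show ?thesis using card_inj_on_le \<open>finite Z\<close> by blast
qed

lemma kth_smallest_exists:
  fixes Z :: "real set"
  assumes "finite Z" "1 \<le> k" "k \<le> card Z"
  shows "\<exists>z\<in>Z. card {x \<in> Z. x \<le> z} = k"
  using assms
proof (induction Z rule: finite_linorder_max_induct)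
  case empty
  then show ?case by simp
next
  case (insert m A)
  have card: "card (insert m A) = Suc (card A)"
    using insert.hyps by (metis card_insert_disjoint less_irrefl)
  show ?case
  proof (cases "k \<le> card A")
    case True
    then obtain z where z: "z \<in> A" "card {x \<in> A. x \<le> z} = k"
      using insert by blast
    then have "{x \<in> insert m A. x \<le> z} = {x \<in> A. x \<le> z}"
      using insert.hyps(2) by force
    then show ?thesis using z by (metis insertI2)
  next
    case False
    then have "k = card (insert m A)" using insert.prems card by simp
    moreover have "{x \<in> insert m A. x \<le> m} = insert m A"
      using insert.hyps(2) by force
    ultimately show ?thesis by auto
  qed
qed

section \<open>Monotonicity of the zeros in the spectral parameter\<close>

theorem theorem3p2:
  fixes a b :: real
    and p s q \<omega> :: "real \<Rightarrow> real"
    and y :: "real \<Rightarrow> real \<Rightarrow> real"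
    and l m :: real
    and k :: nat and t :: real
  assumes "a < b"
    and "continuous_on {a..b} p" and "continuous_on {a..b} s"
    and "continuous_on {a..b} q" and "continuous_on {a..b} \<omega>"
    and "\<And>x. x \<in> {a..b} \<Longrightarrow> p x > 0"
    and "\<And>x. x \<in> {a..b} \<Longrightarrow> \<omega> x > 0"
    and "\<And>r. sl_solution a b p s q \<omega> r (y r)"
    and "\<And>r. \<exists>x\<in>{a..b}. y r x \<noteq> 0"
    and "\<And>r. y r a = 0"
    and "\<And>r. deriv_on a b (y r) a > 0"
    and "l < m"
    and "kth_zero a b (y l) k t"
  shows "\<exists>u. kth_zero a b (y m) k u \<and> u < t"
proof -
  let ?A = "{x \<in> {a<..t}. y l x = 0}" and ?Z = "{x \<in> {a<..<t}. y m x = 0}"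
  have k: "k \<ge> 1" "a < t" "t \<le> b" "finite ?A" "card ?A = k"
    using assms(13) unfolding kth_zero_def by auto
  have sys: "sl_system a b p s q \<omega> r (y r) (quasi_deriv a b p s (y r))" for r
    using assms(6,8) by (intro sl_solution_imp_sl_system)
  have fin: "finite {x \<in> {a..b}. y m x = 0}"
    using finite_zeros[OF sys assms(2-6) assms(9)] .
  then have finZ: "finite ?Z"
    by (rule finite_subset[rotated]) (use k in auto)
  have "card ?A \<le> card ?Z"
  proof (rule card_le_if_gaps_hit[OF finZ, where a = a])
    fix x assume x: "x \<in> ?A"
    define P where "P = {c \<in> insert a ?A. c < x}"
    define c where "c = Max P"
    have P: "finite P" "a \<in> P" using k x unfolding P_def by auto
    then have c: "c \<in> P" "\<And>c'. c' \<in> P \<Longrightarrow> c' \<le> c"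
      unfolding c_def by (auto intro: Max_in)
    have "a \<le> c" "c < x" "x \<le> b" "y l c = 0" "y l x = 0"
      using c P x k assms(10) unfolding P_def by auto
    moreover have "y l z \<noteq> 0" if "c < z" "z < x" for z
      using c(2)[of z] that \<open>a \<le> c\<close> x unfolding P_def by force
    ultimately obtain z where z: "c < z" "z < x" "y m z = 0"
      using sturm_comparison[OF sys sys assms(6,7) assms(12)] by metis
    then show "\<exists>z\<in>?Z. z < x \<and> (\<forall>c\<in>insert a ?A. c < x \<longrightarrow> c < z)"
      using c(2) \<open>a \<le> c\<close> x unfolding P_def by (intro bexI[of _ z]) force+
  qed
  then obtain u where u: "u \<in> ?Z" "card {x \<in> ?Z. x \<le> u} = k"
    using kth_smallest_exists[OF finZ k(1)] k(5) by auto
  have "{x \<in> {a<..u}. y m x = 0} = {x \<in> ?Z. x \<le> u}"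
    using u(1) by auto
  moreover have "finite {x \<in> ?Z. x \<le> u}"
    using finZ by (rule finite_subset[rotated]) auto
  ultimately have "kth_zero a b (y m) k u"
    using u k(1,3) unfolding kth_zero_def by auto
  then show ?thesis using u(1) by auto
qed

end
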